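(* Let $\phi$ be a TTL$[X_\theta,Y_\theta]$ formula. For every subformula (occurrence) $\eta$ of $\phi$ one can construct an MITL$[F,P]$ formula $\beta(\eta)$ such that for every timed word $\rho$: $eval_\rho(\eta)$ holds iff $pos_\rho(\eta)\neq\bot$ and $\rho,pos_\rho(\eta)\models\beta(\eta)$. In particular (taking $\eta=\phi$) $\rho,1,\nu_0\models\phi$ iff $\rho,1\models\beta(\phi)$.
   Context: Fix a finite alphabet $\Sigma$. A timed word is $\rho=(\sigma_1,\tau_1)\cdots(\sigma_n,\tau_n)$, $n\ge1$, $\sigma_i\in\Sigma$, $\tau_i\in\mathbb{R}_{\ge0}$, $\tau_1=0$, $\tau_i\le\tau_{i+1}$; $\#\rho=n$, $dom(\rho)=\{1,\dots,n\}$. Freeze variables: a finite set $\mathcal{X}$; valuations $\nu:\mathcal{X}\to\mathbb{R}_{\ge0}$, $\nu_0\equiv0$. Guards $g::=g\wedge g\mid x-T\approx c$ ($\approx\in\{<,\le,>,\ge,=\}$, $c\in\mathbb{Z}$), $\nu,t\models x-T\approx c$ iff $\nu(x)-t\approx c$. A guarded event is $\theta=(a,g)$, $a\in\Sigma$. TTL$[X_\theta,Y_\theta]$ formulas: $\phi::=\top\mid\theta\mid SP\phi\mid EP\phi\mid X_\theta\phi\mid Y_\theta\phi\mid x.\phi\mid\phi\vee\phi\mid\neg\phi$, with: $\rho,i,\nu\models\theta$ iff $\sigma_i=a$ and $\nu,\tau_i\models g$; $\rho,i,\nu\models SP\phi$ iff $\rho,1,\nu\models\phi$; $\rho,i,\nu\models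 EP\phi$ iff $\rho,\#\rho,\nu\models\phi$; $\rho,i,\nu\models X_\theta\phi$ iff there is $j>i$ with $\rho,j,\nu\models\theta$, $\rho,k,\nu\not\models\theta$ for all $i<k<j$, and $\rho,j,\nu\models\phi$; $Y_\theta$ symmetric to the left; $\rho,i,\nu\models x.\phi$ iff $\rho,i,\nu[x\mapsto\tau_i]\models\phi$. Subformulas are nodes of the parse tree of $\phi$; $\eta_{root}=\phi$. For a timed word $\rho$, $pos_\rho(\eta)\in dom(\rho)\cup\{\bot\}$ and (when $pos_\rho(\eta)\neq\bot$) a valuation $val_\rho(\eta)$ are defined top-down: $pos_\rho(\eta_{root})=1$, $val_\rho(\eta_{root})=\nu_0$; if $pos_\rho(\eta)=\bot$ then all children have $pos=\bot$; otherwise let $pos_\rho(\eta)=i$, $val_\rho(\eta)=\nu$: if $\eta=SP\eta_1$ then $pos_\rho(\eta_1)=1$; if $\eta=EP\eta_1$ then $pos_\rho(\eta_1)=\#\rho$; if $\eta=\eta_1\vee\eta_2$ or $\neg\eta_1$ the children have position $i$; in these cases the children get valuation $\nu$; if $\eta=x.\eta_1$ then $pos_\rho(\eta_1)=i$, $val_\rho(\eta_1)=\nu[x\mapsto\tau_i]$; if $\eta=X_\theta\eta_1$ then $pos_\rho(\eta_1)$ is the least $j>i$ with $\rho,j,\nu\models\theta$ ($\bot$ if none) and $val_\rho(\eta_1)=\nu$; $Y_\theta\eta_1$ symmetric (greatest $j<i$). Define $eval_\rho(\eta)$ to be true iff $pos_\rho(\eta)\neq\bot$ and $\rho,pos_\rho(\eta),val_\rho(\eta)\models\eta$.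 MITL$[F,P]$ formulas: $\psi::=a\mid\psi\wedge\psi\mid\neg\psi\mid F_I\psi\mid P_I\psi$ with $I$ a non-singular interval (convex subset of $\mathbb{R}_{\ge0}$ with non-negative integer or $\infty$ endpoints, not of form $[c,c]$); $\rho,i\models F_I\psi$ iff $\exists j>i$: $\tau_j-\tau_i\in I$, $\rho,j\models\psi$; $\rho,i\models P_I\psi$ iff $\exists j<i$: $\tau_i-\tau_j\in I$, $\rho,j\models\psi$. *)

theory Defs
  imports Complex_Main
begin

text \<open>The finite alphabet is the universe of a type \<open>'a\<close> of class \<open>finite\<close>, and the finite set
  of freeze variables is the universe of a type \<open>'x\<close> of class \<open>finite\<close>. Positions of a timed word
  are counted from 1, as in the mathematics, while lists are indexed from 0.\<close>

type_synonym 'a tword = "('a \<times> real) list"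

definition tw_dom :: "'a tword \<Rightarrow> nat set" where
  "tw_dom \<rho> = {1..length \<rho>}"

definition tw_sym :: "'a tword \<Rightarrow> nat \<Rightarrow> 'a" where
  "tw_sym \<rho> i = fst (\<rho> ! (i - 1))"

definition tw_time :: "'a tword \<Rightarrow> nat \<Rightarrow> real" where
  "tw_time \<rho> i = snd (\<rho> ! (i - 1))"

definition timed_word :: "'a tword \<Rightarrow> bool" where
  "timed_word \<rho> \<longleftrightarrow> length \<rho> \<ge> 1 \<and> (\<forall>i\<in>tw_dom \<rho>. 0 \<le> tw_time \<rho> i) \<and> tw_time \<rho> 1 = 0 \<and>
     (\<forall>i. i \<in> tw_dom \<rho> \<and> i + 1 \<in> tw_dom \<rho> \<longrightarrow> tw_time \<rho> i \<le> tw_time \<rho> (i + 1))"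

text \<open>Valuations are real-valued; all valuations that arise from \<open>\<nu>\<^sub>0\<close> by freezing at positions of a
  timed word are non-negative.\<close>

type_synonym 'x valuation = "'x \<Rightarrow> real"

definition val_zero :: "'x valuation" ("\<nu>\<^sub>0") where
  "\<nu>\<^sub>0 = (\<lambda>_. 0)"

datatype cmp = CLt | CLe | CGt | CGe | CEq

fun cmp_holds :: "cmp \<Rightarrow> real \<Rightarrow> real \<Rightarrow> bool" where
  "cmp_holds CLt u v \<longleftrightarrow> u < v"
| "cmp_holds CLe u v \<longleftrightarrow> u \<le> v"
| "cmp_holds CGt u v \<longleftrightarrow> u > v"
| "cmp_holds CGe u v \<longleftrightarrow> u \<ge> v"
| "cmp_holds CEq u v \<longleftrightarrow> u = v"

text \<open>\<open>GDiff x r c\<close> is the constraint comparing \<open>x - T\<close> with the integer \<open>c\<close> by \<open>r\<close>.\<close>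

datatype 'x guard = GAnd "'x guard" "'x guard" | GDiff 'x cmp int

fun guard_sat :: "'x valuation \<Rightarrow> real \<Rightarrow> 'x guard \<Rightarrow> bool" where
  "guard_sat \<nu> t (GAnd g h) \<longleftrightarrow> guard_sat \<nu> t g \<and> guard_sat \<nu> t h"
| "guard_sat \<nu> t (GDiff x r c) \<longleftrightarrow> cmp_holds r (\<nu> x - t) (of_int c)"

type_synonym ('a, 'x) gevent = "'a \<times> 'x guard"

definition gevent_sat :: "'a tword \<Rightarrow> nat \<Rightarrow> 'x valuation \<Rightarrow> ('a, 'x) gevent \<Rightarrow> bool" where
  "gevent_sat \<rho> i \<nu> \<theta> \<longleftrightarrow> tw_sym \<rho> i = fst \<theta> \<and> guard_sat \<nu> (tw_time \<rho> i) (snd \<theta>)"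

datatype ('a, 'x) ttl =
    TTop
  | TEvent "('a, 'x) gevent"
  | TSP "('a, 'x) ttl"
  | TEP "('a, 'x) ttl"
  | TX "('a, 'x) gevent" "('a, 'x) ttl"
  | TY "('a, 'x) gevent" "('a, 'x) ttl"
  | TFreeze 'x "('a, 'x) ttl"
  | TOr "('a, 'x) ttl" "('a, 'x) ttl"
  | TNot "('a, 'x) ttl"

fun ttl_sat :: "'a tword \<Rightarrow> nat \<Rightarrow> 'x valuation \<Rightarrow> ('a, 'x) ttl \<Rightarrow> bool" where
  "ttl_sat \<rho> i \<nu> TTop \<longleftrightarrow> True"
| "ttl_sat \<rho> i \<nu> (TEvent \<theta>) \<longleftrightarrow> gevent_sat \<rho> i \<nu> \<theta>"
| "ttl_sat \<rho> i \<nu> (TSP \<phi>) \<longleftrightarrow> ttl_sat \<rho> 1 \<nu> \<phi>"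
| "ttl_sat \<rho> i \<nu> (TEP \<phi>) \<longleftrightarrow> ttl_sat \<rho> (length \<rho>) \<nu> \<phi>"
| "ttl_sat \<rho> i \<nu> (TX \<theta> \<phi>) \<longleftrightarrow>
     (\<exists>j\<in>tw_dom \<rho>. i < j \<and> gevent_sat \<rho> j \<nu> \<theta> \<and>
        (\<forall>k. i < k \<and> k < j \<longrightarrow> \<not> gevent_sat \<rho> k \<nu> \<theta>) \<and> ttl_sat \<rho> j \<nu> \<phi>)"
| "ttl_sat \<rho> i \<nu> (TY \<theta> \<phi>) \<longleftrightarrow>
     (\<exists>j\<in>tw_dom \<rho>. j < i \<and> gevent_sat \<rho> j \<nu> \<theta> \<and>
        (\<forall>k. j < k \<and> k < i \<longrightarrow> \<not> gevent_sat \<rho> k \<nu> \<theta>) \<and> ttl_sat \<rho> j \<nu> \<phi>)"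
| "ttl_sat \<rho> i \<nu> (TFreeze x \<phi>) \<longleftrightarrow> ttl_sat \<rho> i (\<nu>(x := tw_time \<rho> i)) \<phi>"
| "ttl_sat \<rho> i \<nu> (TOr \<phi> \<psi>) \<longleftrightarrow> ttl_sat \<rho> i \<nu> \<phi> \<or> ttl_sat \<rho> i \<nu> \<psi>"
| "ttl_sat \<rho> i \<nu> (TNot \<phi>) \<longleftrightarrow> \<not> ttl_sat \<rho> i \<nu> \<phi>"

text \<open>Nodes of the parse tree of a formula, that is, occurrences of subformulas, are addressed by
  the list of child indices leading from the root \<open>[]\<close> to the node. The guarded event of
  \<open>X\<^sub>\<theta>\<close> and \<open>Y\<^sub>\<theta>\<close> is part of the modality and not a child.\<close>

fun ttl_children :: "('a, 'x) ttl \<Rightarrow> ('a, 'x) ttl list" where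
  "ttl_children TTop = []"
| "ttl_children (TEvent \<theta>) = []"
| "ttl_children (TSP \<phi>) = [\<phi>]"
| "ttl_children (TEP \<phi>) = [\<phi>]"
| "ttl_children (TX \<theta> \<phi>) = [\<phi>]"
| "ttl_children (TY \<theta> \<phi>) = [\<phi>]"
| "ttl_children (TFreeze x \<phi>) = [\<phi>]"
| "ttl_children (TOr \<phi> \<psi>) = [\<phi>, \<psi>]"
| "ttl_children (TNot \<phi>) = [\<phi>]"

fun is_node :: "('a, 'x) ttl \<Rightarrow> nat list \<Rightarrow> bool" where
  "is_node \<phi> [] \<longleftrightarrow> True"
| "is_node \<phi> (k # p) \<longleftrightarrow> k < length (ttl_children \<phi>) \<and> is_node (ttl_children \<phi> ! k) p"

fun subformula_at :: "('a, 'x) ttl \<Rightarrow> nat list \<Rightarrow> ('a, 'x) ttl" where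
  "subformula_at \<phi> [] = \<phi>"
| "subformula_at \<phi> (k # p) = subformula_at (ttl_children \<phi> ! k) p"

definition next_pos :: "'a tword \<Rightarrow> nat \<Rightarrow> 'x valuation \<Rightarrow> ('a, 'x) gevent \<Rightarrow> nat option" where
  "next_pos \<rho> i \<nu> \<theta> =
     (let J = {j \<in> tw_dom \<rho>. i < j \<and> gevent_sat \<rho> j \<nu> \<theta>} in if J = {} then None else Some (Min J))"

definition prev_pos :: "'a tword \<Rightarrow> nat \<Rightarrow> 'x valuation \<Rightarrow> ('a, 'x) gevent \<Rightarrow> nat option" where
  "prev_pos \<rho> i \<nu> \<theta> =
     (let J = {j \<in> tw_dom \<rho>. j < i \<and> gevent_sat \<rho> j \<nu> \<theta>} in if J = {} then None else Some (Max J))"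

text \<open>The pair of position and valuation passed from a node \<open>\<eta>\<close> (at position \<open>i\<close> with valuation
  \<open>\<nu>\<close>) to each of its children; \<open>None\<close> encodes \<open>\<bottom>\<close>. The values for \<open>TTop\<close> and \<open>TEvent\<close>,
  which have no children, are irrelevant.\<close>

fun child_config ::
  "'a tword \<Rightarrow> ('a, 'x) ttl \<Rightarrow> nat \<Rightarrow> 'x valuation \<Rightarrow> (nat \<times> 'x valuation) option" where
  "child_config \<rho> TTop i \<nu> = None"
| "child_config \<rho> (TEvent \<theta>) i \<nu> = None"
| "child_config \<rho> (TSP \<phi>) i \<nu> = Some (1, \<nu>)"
| "child_config \<rho> (TEP \<phi>) i \<nu> = Some (length \<rho>, \<nu>)"
| "child_config \<rho> (TX \<theta> \<phi>) i \<nu> = map_option (\<lambda>j. (j, \<nu>)) (next_pos \<rho> i \<nu> \<theta>)"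
| "child_config \<rho> (TY \<theta> \<phi>) i \<nu> = map_option (\<lambda>j. (j, \<nu>)) (prev_pos \<rho> i \<nu> \<theta>)"
| "child_config \<rho> (TFreeze x \<phi>) i \<nu> = Some (i, \<nu>(x := tw_time \<rho> i))"
| "child_config \<rho> (TOr \<phi> \<psi>) i \<nu> = Some (i, \<nu>)"
| "child_config \<rho> (TNot \<phi>) i \<nu> = Some (i, \<nu>)"

fun config_from ::
  "'a tword \<Rightarrow> ('a, 'x) ttl \<Rightarrow> (nat \<times> 'x valuation) option \<Rightarrow> nat list
     \<Rightarrow> (nat \<times> 'x valuation) option" where
  "config_from \<rho> \<eta> c [] = c"
| "config_from \<rho> \<eta> None (k # p) = None"
| "config_from \<rho> \<eta> (Some (i, \<nu>)) (k # p) =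
     config_from \<rho> (ttl_children \<eta> ! k) (child_config \<rho> \<eta> i \<nu>) p"

definition ttl_pos :: "'a tword \<Rightarrow> ('a, 'x) ttl \<Rightarrow> nat list \<Rightarrow> nat option" where
  "ttl_pos \<rho> \<phi> p = map_option fst (config_from \<rho> \<phi> (Some (1, \<nu>\<^sub>0)) p)"

text \<open>Meaningful only if \<open>ttl_pos \<rho> \<phi> p \<noteq> None\<close>.\<close>

definition ttl_val :: "'a tword \<Rightarrow> ('a, 'x) ttl \<Rightarrow> nat list \<Rightarrow> 'x valuation" where
  "ttl_val \<rho> \<phi> p = snd (the (config_from \<rho> \<phi> (Some (1, \<nu>\<^sub>0)) p))"

definition ttl_eval :: "'a tword \<Rightarrow> ('a, 'x) ttl \<Rightarrow> nat list \<Rightarrow> bool" where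
  "ttl_eval \<rho> \<phi> p \<longleftrightarrow> ttl_pos \<rho> \<phi> p \<noteq> None \<and>
     ttl_sat \<rho> (the (ttl_pos \<rho> \<phi> p)) (ttl_val \<rho> \<phi> p) (subformula_at \<phi> p)"

definition nat_interval :: "real set \<Rightarrow> bool" where
  "nat_interval I \<longleftrightarrow>
     (\<exists>l::nat. I = {real l..} \<or> I = {real l<..} \<or>
        (\<exists>u::nat. I = {real l..real u} \<or> I = {real l<..real u} \<or>
           I = {real l..<real u} \<or> I = {real l<..<real u}))"

typedef ns_interval = "{I :: real set. nat_interval I \<and> (\<forall>c. I \<noteq> {c..c})}"
proof -
  have "nat_interval {0..}"
    unfolding nat_interval_def by (rule exI[of _ 0]) simp
  moreover have "\<forall>c. {0::real..} \<noteq> {c..c}"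
  proof
    fix c :: real
    have "\<bar>c\<bar> + 1 \<in> {0..}" "\<bar>c\<bar> + 1 \<notin> {c..c}"
      by auto
    then show "{0..} \<noteq> {c..c}"
      by blast
  qed
  ultimately show ?thesis
    by blast
qed

datatype 'a mitl =
    MAtom 'a
  | MAnd "'a mitl" "'a mitl"
  | MNot "'a mitl"
  | MF ns_interval "'a mitl"
  | MP ns_interval "'a mitl"

fun mitl_sat :: "'a tword \<Rightarrow> nat \<Rightarrow> 'a mitl \<Rightarrow> bool" where
  "mitl_sat \<rho> i (MAtom a) \<longleftrightarrow> tw_sym \<rho> i = a"
| "mitl_sat \<rho> i (MAnd \<psi> \<chi>) \<longleftrightarrow> mitl_sat \<rho> i \<psi> \<and> mitl_sat \<rho> i \<chi>"
| "mitl_sat \<rho> i (MNot \<psi>) \<longleftrightarrow> \<not> mitl_sat \<rho> i \<psi>"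
| "mitl_sat \<rho> i (MF I \<psi>) \<longleftrightarrow>
     (\<exists>j\<in>tw_dom \<rho>. i < j \<and> tw_time \<rho> j - tw_time \<rho> i \<in> Rep_ns_interval I \<and> mitl_sat \<rho> j \<psi>)"
| "mitl_sat \<rho> i (MP I \<psi>) \<longleftrightarrow>
     (\<exists>j\<in>tw_dom \<rho>. j < i \<and> tw_time \<rho> i - tw_time \<rho> j \<in> Rep_ns_interval I \<and> mitl_sat \<rho> j \<psi>)"

end

theory Submission
  imports Defs
begin

text \<open>TTL is deterministic: a node of the parse tree is visited at no more than one position of a
  timed word. Top-down along the parse tree one builds an MITL formula that holds exactly at this
  position, together with, for every freeze variable, a formula that holds exactly at the position
  where the variable was last frozen (the first position, if it never was). Since that position is
  unique, a guard \<open>x - T \<approx> c\<close> can be tested by looking for it at distance at least or more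
  than an integer, so that even punctual guards only need intervals unbounded to the right.
  A child of \<open>X\<^sub>\<theta>\<close> sits where \<open>\<theta>\<close> holds after the position of the parent, but has not held
  in between; both are unary past properties. Truth is then propagated bottom-up by
  looking for the unique position of the child.\<close>

section \<open>Order of time stamps and the two ends of the domain\<close>

lemma tw_time_mono:
  assumes "timed_word \<rho>" "i \<in> tw_dom \<rho>" "j \<in> tw_dom \<rho>" "i \<le> j"
  shows "tw_time \<rho> i \<le> tw_time \<rho> j"
  using assms(4,3)
proof (induction j rule: dec_induct)
  case (step n)
  then have "n \<in> tw_dom \<rho>" "n + 1 \<in> tw_dom \<rho>"
    using assms(2) by (auto simp: tw_dom_def)
  then have "tw_time \<rho> n \<le> tw_time \<rho> (n + 1)"
    using assms(1) unfolding timed_word_def by blast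
  with step \<open>n \<in> tw_dom \<rho>\<close> show ?case
    by simp
qed simp

lemma first_in_tw_dom: "timed_word \<rho> \<Longrightarrow> 1 \<in> tw_dom \<rho>"
  by (simp add: timed_word_def tw_dom_def)

lemma last_in_tw_dom: "timed_word \<rho> \<Longrightarrow> length \<rho> \<in> tw_dom \<rho>"
  by (simp add: timed_word_def tw_dom_def)

section \<open>Right-unbounded intervals and derived MITL operators\<close>

definition at_least :: "nat \<Rightarrow> ns_interval" where
  "at_least n = Abs_ns_interval {real n..}"

definition more_than :: "nat \<Rightarrow> ns_interval" where
  "more_than n = Abs_ns_interval {real n<..}"

lemma Rep_at_least [simp]: "Rep_ns_interval (at_least n) = {real n..}"
proof -
  have "{real n..} \<noteq> {c..c}" for c
  proof -
    have "real n \<in> {real n..}" "real n + 1 \<in> {real n..}"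
      by auto
    then show ?thesis
      by (metis atLeastAtMost_singleton add_cancel_right_right singletonD zero_neq_one)
  qed
  then show ?thesis
    unfolding at_least_def by (subst Abs_ns_interval_inverse) (auto simp: nat_interval_def)
qed

lemma Rep_more_than [simp]: "Rep_ns_interval (more_than n) = {real n<..}"
proof -
  have "{real n<..} \<noteq> {c..c}" for c
  proof -
    have "real n + 1 \<in> {real n<..}" "real n + 2 \<in> {real n<..}"
      by auto
    moreover have "real n + 1 \<noteq> real n + 2"
      by simp
    ultimately show ?thesis
      by (metis atLeastAtMost_singleton singletonD)
  qed
  then show ?thesis
    unfolding more_than_def by (subst Abs_ns_interval_inverse) (auto simp: nat_interval_def)
qed

text \<open>MITL has no truth constant. \<open>undefined\<close> is some letter, and which one is
  immaterial because a contradiction is negated.\<close>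

definition mitl_top :: "'a mitl" where
  "mitl_top = MNot (MAnd (MAtom undefined) (MNot (MAtom undefined)))"

definition mitl_or :: "'a mitl \<Rightarrow> 'a mitl \<Rightarrow> 'a mitl" where
  "mitl_or \<psi> \<chi> = MNot (MAnd (MNot \<psi>) (MNot \<chi>))"

definition mitl_future :: "'a mitl \<Rightarrow> 'a mitl" where
  "mitl_future \<psi> = MF (at_least 0) \<psi>"

definition mitl_past :: "'a mitl \<Rightarrow> 'a mitl" where
  "mitl_past \<psi> = MP (at_least 0) \<psi>"

definition mitl_somewhere :: "'a mitl \<Rightarrow> 'a mitl" where
  "mitl_somewhere \<psi> = mitl_or \<psi> (mitl_or (mitl_past \<psi>) (mitl_future \<psi>))"

definition mitl_first :: "'a mitl" where
  "mitl_first = MNot (mitl_past mitl_top)"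

definition mitl_last :: "'a mitl" where
  "mitl_last = MNot (mitl_future mitl_top)"

lemma mitl_sat_top [simp]: "mitl_sat \<rho> i mitl_top"
  by (simp add: mitl_top_def)

lemma mitl_sat_or [simp]: "mitl_sat \<rho> i (mitl_or \<psi> \<chi>) \<longleftrightarrow> mitl_sat \<rho> i \<psi> \<or> mitl_sat \<rho> i \<chi>"
  by (simp add: mitl_or_def)

text \<open>By monotonicity, later positions are at distance at least 0, so the interval
  \<open>at_least 0\<close> excludes none of them, not even those with an equal time stamp.\<close>

lemma mitl_sat_future:
  assumes "timed_word \<rho>" "i \<in> tw_dom \<rho>"
  shows "mitl_sat \<rho> i (mitl_future \<psi>) \<longleftrightarrow> (\<exists>j\<in>tw_dom \<rho>. i < j \<and> mitl_sat \<rho> j \<psi>)"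
  using tw_time_mono[OF assms] by (auto simp: mitl_future_def)

lemma mitl_sat_past:
  assumes "timed_word \<rho>" "i \<in> tw_dom \<rho>"
  shows "mitl_sat \<rho> i (mitl_past \<psi>) \<longleftrightarrow> (\<exists>j\<in>tw_dom \<rho>. j < i \<and> mitl_sat \<rho> j \<psi>)"
  using tw_time_mono[OF assms(1) _ assms(2)] by (auto simp: mitl_past_def)

lemma mitl_sat_somewhere:
  assumes "timed_word \<rho>" "i \<in> tw_dom \<rho>"
  shows "mitl_sat \<rho> i (mitl_somewhere \<psi>) \<longleftrightarrow> (\<exists>j\<in>tw_dom \<rho>. mitl_sat \<rho> j \<psi>)"
  using assms by (auto simp: mitl_somewhere_def mitl_sat_past mitl_sat_future)
    (metis linorder_neqE_nat)

lemma mitl_sat_first: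
  assumes "timed_word \<rho>" "i \<in> tw_dom \<rho>"
  shows "mitl_sat \<rho> i mitl_first \<longleftrightarrow> i = 1"
proof -
  have "mitl_sat \<rho> i mitl_first \<longleftrightarrow> \<not> (\<exists>j\<in>tw_dom \<rho>. j < i)"
    using assms by (simp add: mitl_first_def mitl_sat_past)
  then show ?thesis
    using assms(2) first_in_tw_dom[OF assms(1)]
    by (metis One_nat_def atLeastAtMost_iff le_antisym not_less tw_dom_def)
qed

lemma mitl_sat_last:
  assumes "timed_word \<rho>" "i \<in> tw_dom \<rho>"
  shows "mitl_sat \<rho> i mitl_last \<longleftrightarrow> i = length \<rho>"
proof -
  have "mitl_sat \<rho> i mitl_last \<longleftrightarrow> \<not> (\<exists>j\<in>tw_dom \<rho>. i < j)"
    using assms by (simp add: mitl_last_def mitl_sat_future)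
  then show ?thesis
    using assms(2) last_in_tw_dom[OF assms(1)] by (force simp: tw_dom_def)
qed

section \<open>Marked positions and the translation of guards\<close>

definition holds_only_at :: "'a tword \<Rightarrow> 'a mitl \<Rightarrow> nat \<Rightarrow> bool" where
  "holds_only_at \<rho> \<psi> k \<longleftrightarrow> k \<in> tw_dom \<rho> \<and> (\<forall>i\<in>tw_dom \<rho>. mitl_sat \<rho> i \<psi> \<longleftrightarrow> i = k)"

text \<open>A value is recorded through a marked position rather than as a number, so the family
  \<open>V\<close> can be chosen independently of the word.\<close>

definition represents :: "'a tword \<Rightarrow> ('x \<Rightarrow> 'a mitl) \<Rightarrow> 'x valuation \<Rightarrow> bool" where
  "represents \<rho> V \<nu> \<longleftrightarrow> (\<forall>x. \<exists>k. holds_only_at \<rho> (V x) k \<and> \<nu> x = tw_time \<rho> k)"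

text \<open>Events at distance 0 can lie on either side. The case distinctions ensure that only distances
  whose sign determines the side are searched for.\<close>

definition diff_ge :: "'a mitl \<Rightarrow> int \<Rightarrow> 'a mitl" where
  "diff_ge \<psi> c = (if c > 0 then MF (at_least (nat c)) \<psi> else MNot (MP (more_than (nat (- c))) \<psi>))"

definition diff_gt :: "'a mitl \<Rightarrow> int \<Rightarrow> 'a mitl" where
  "diff_gt \<psi> c = (if c \<ge> 0 then MF (more_than (nat c)) \<psi> else MNot (MP (at_least (nat (- c))) \<psi>))"

text \<open>Monotonicity supplies the order: a positive difference puts \<open>k\<close> after
  \<open>i\<close>, a negative one before. For \<open>c > 0\<close> every difference searched for is
  positive; for \<open>c \<le> 0\<close> the formula denies a difference below \<open>c\<close>,
  which would be negative.\<close>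

lemma mitl_sat_diff_ge:
  assumes "timed_word \<rho>" "i \<in> tw_dom \<rho>" "holds_only_at \<rho> \<psi> k"
  shows "mitl_sat \<rho> i (diff_ge \<psi> c) \<longleftrightarrow> tw_time \<rho> k - tw_time \<rho> i \<ge> of_int c"
proof (cases "c > 0")
  case True
  have "mitl_sat \<rho> i (diff_ge \<psi> c) \<longleftrightarrow> i < k \<and> tw_time \<rho> k - tw_time \<rho> i \<ge> of_int c"
    using True assms(3) by (auto simp: diff_ge_def holds_only_at_def)
  moreover have "i < k" if "tw_time \<rho> k - tw_time \<rho> i \<ge> of_int c"
    using that True tw_time_mono[OF assms(1), of k i] assms(2,3)
    by (force simp: holds_only_at_def not_less)
  ultimately show ?thesis
    by blast
next
  case False
  have "mitl_sat \<rho> i (diff_ge \<psi> c) \<longleftrightarrow> \<not> (k < i \<and> tw_time \<rho> k - tw_time \<rho> i < of_int c)"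
    using False assms(3) by (auto simp: diff_ge_def holds_only_at_def)
  moreover have "k < i" if "tw_time \<rho> k - tw_time \<rho> i < of_int c"
    using that False tw_time_mono[OF assms(1), of i k] assms(2,3)
    by (force simp: holds_only_at_def not_less)
  ultimately show ?thesis
    by fastforce
qed

text \<open>As for \<open>diff_ge\<close>, but \<open>c = 0\<close> now belongs to the future case:
  a difference above 0 determines the side, whereas one that is at most 0 may vanish.\<close>

lemma mitl_sat_diff_gt:
  assumes "timed_word \<rho>" "i \<in> tw_dom \<rho>" "holds_only_at \<rho> \<psi> k"
  shows "mitl_sat \<rho> i (diff_gt \<psi> c) \<longleftrightarrow> tw_time \<rho> k - tw_time \<rho> i > of_int c"
proof (cases "c \<ge> 0")
  case True
  have "mitl_sat \<rho> i (diff_gt \<psi> c) \<longleftrightarrow> i < k \<and> tw_time \<rho> k - tw_time \<rho> i > of_int c"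
    using True assms(3) by (auto simp: diff_gt_def holds_only_at_def)
  moreover have "i < k" if "tw_time \<rho> k - tw_time \<rho> i > of_int c"
    using that True tw_time_mono[OF assms(1), of k i] assms(2,3)
    by (force simp: holds_only_at_def not_less)
  ultimately show ?thesis
    by blast
next
  case False
  have "mitl_sat \<rho> i (diff_gt \<psi> c) \<longleftrightarrow> \<not> (k < i \<and> tw_time \<rho> k - tw_time \<rho> i \<le> of_int c)"
    using False assms(3) by (auto simp: diff_gt_def holds_only_at_def)
  moreover have "k < i" if "tw_time \<rho> k - tw_time \<rho> i \<le> of_int c"
    using that False tw_time_mono[OF assms(1), of i k] assms(2,3)
    by (force simp: holds_only_at_def not_less)
  ultimately show ?thesis
    by fastforce
qed

text \<open>Searching for distance exactly \<open>c\<close> would take a singular interval;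
  \<open>CEq\<close> combines \<open>\<ge>\<close> with the negation of \<open>>\<close>
  instead.\<close>

fun cmp_mitl :: "cmp \<Rightarrow> 'a mitl \<Rightarrow> int \<Rightarrow> 'a mitl" where
  "cmp_mitl CLt \<psi> c = MNot (diff_ge \<psi> c)"
| "cmp_mitl CLe \<psi> c = MNot (diff_gt \<psi> c)"
| "cmp_mitl CGt \<psi> c = diff_gt \<psi> c"
| "cmp_mitl CGe \<psi> c = diff_ge \<psi> c"
| "cmp_mitl CEq \<psi> c = MAnd (diff_ge \<psi> c) (MNot (diff_gt \<psi> c))"

fun guard_mitl :: "('x \<Rightarrow> 'a mitl) \<Rightarrow> 'x guard \<Rightarrow> 'a mitl" where
  "guard_mitl V (GAnd g h) = MAnd (guard_mitl V g) (guard_mitl V h)"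
| "guard_mitl V (GDiff x r c) = cmp_mitl r (V x) c"

definition gevent_mitl :: "('x \<Rightarrow> 'a mitl) \<Rightarrow> ('a, 'x) gevent \<Rightarrow> 'a mitl" where
  "gevent_mitl V \<theta> = MAnd (MAtom (fst \<theta>)) (guard_mitl V (snd \<theta>))"

lemma mitl_sat_guard:
  assumes "timed_word \<rho>" "i \<in> tw_dom \<rho>" "represents \<rho> V \<nu>"
  shows "mitl_sat \<rho> i (guard_mitl V g) \<longleftrightarrow> guard_sat \<nu> (tw_time \<rho> i) g"
proof (induction g)
  case (GDiff x r c)
  obtain k where "holds_only_at \<rho> (V x) k" "\<nu> x = tw_time \<rho> k"
    using assms(3) unfolding represents_def by blast
  then show ?case
    using assms(1,2) by (cases r) (auto simp: mitl_sat_diff_ge mitl_sat_diff_gt)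
qed simp

lemma mitl_sat_gevent:
  assumes "timed_word \<rho>" "i \<in> tw_dom \<rho>" "represents \<rho> V \<nu>"
  shows "mitl_sat \<rho> i (gevent_mitl V \<theta>) \<longleftrightarrow> gevent_sat \<rho> i \<nu> \<theta>"
  using mitl_sat_guard[OF assms] by (simp add: gevent_mitl_def gevent_sat_def)

section \<open>Nearest events and the configuration of a child\<close>

lemma next_pos_eq_Some_iff:
  "next_pos \<rho> i \<nu> \<theta> = Some j \<longleftrightarrow>
     j \<in> tw_dom \<rho> \<and> i < j \<and> gevent_sat \<rho> j \<nu> \<theta> \<and>
     (\<forall>k\<in>tw_dom \<rho>. i < k \<and> k < j \<longrightarrow> \<not> gevent_sat \<rho> k \<nu> \<theta>)"
proof -
  let ?J = "{j \<in> tw_dom \<rho>. i < j \<and> gevent_sat \<rho> j \<nu> \<theta>}"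
  have "finite ?J"
    by (simp add: tw_dom_def)
  \<comment> \<open>The empty set is covered too: both sides then fail for every
    \<open>j\<close>.\<close>
  then have "next_pos \<rho> i \<nu> \<theta> = Some j \<longleftrightarrow> j \<in> ?J \<and> (\<forall>k\<in>?J. j \<le> k)"
    by (auto simp: next_pos_def Let_def Min_eq_iff)
  then show ?thesis
    by (auto simp: not_less[symmetric])
qed

lemma prev_pos_eq_Some_iff:
  "prev_pos \<rho> i \<nu> \<theta> = Some j \<longleftrightarrow>
     j \<in> tw_dom \<rho> \<and> j < i \<and> gevent_sat \<rho> j \<nu> \<theta> \<and>
     (\<forall>k\<in>tw_dom \<rho>. j < k \<and> k < i \<longrightarrow> \<not> gevent_sat \<rho> k \<nu> \<theta>)"
proof -
  let ?J = "{j \<in> tw_dom \<rho>. j < i \<and> gevent_sat \<rho> j \<nu> \<theta>}"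
  have "finite ?J"
    by (simp add: tw_dom_def)
  then have "prev_pos \<rho> i \<nu> \<theta> = Some j \<longleftrightarrow> j \<in> ?J \<and> (\<forall>k\<in>?J. k \<le> j)"
    by (auto simp: prev_pos_def Let_def Max_eq_iff)
  then show ?thesis
    by (auto simp: not_less[symmetric])
qed

text \<open>For \<open>None\<close> there is no valuation, hence no condition on \<open>V\<close>;
  the formulas can thus be built without knowing whether a given word reaches the node.\<close>

definition encodes ::
  "'a mitl \<Rightarrow> ('x \<Rightarrow> 'a mitl) \<Rightarrow> 'a tword \<Rightarrow> (nat \<times> 'x valuation) option \<Rightarrow> bool" where
  "encodes \<alpha> V \<rho> c \<longleftrightarrow>
     (case c of
        None \<Rightarrow> \<forall>i\<in>tw_dom \<rho>. \<not> mitl_sat \<rho> i \<alpha>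
      | Some (j, \<nu>) \<Rightarrow> holds_only_at \<rho> \<alpha> j \<and> represents \<rho> V \<nu>)"

text \<open>The conjunct \<open>mitl_somewhere \<alpha>\<close> passes \<open>\<bottom>\<close> on:
  otherwise the child of \<open>TSP\<close> or \<open>TEP\<close> would be marked even when the
  parent is not reached. For \<open>TX\<close> and \<open>TY\<close>, \<open>\<psi>\<close> marks
  all events on the proper side of the parent, and the negated conjunct keeps the nearest.\<close>

fun child_pos_mitl :: "('a, 'x) ttl \<Rightarrow> 'a mitl \<Rightarrow> ('x \<Rightarrow> 'a mitl) \<Rightarrow> 'a mitl" where
  "child_pos_mitl TTop \<alpha> V = MNot mitl_top"
| "child_pos_mitl (TEvent \<theta>) \<alpha> V = MNot mitl_top"
| "child_pos_mitl (TSP \<eta>) \<alpha> V = MAnd mitl_first (mitl_somewhere \<alpha>)"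
| "child_pos_mitl (TEP \<eta>) \<alpha> V = MAnd mitl_last (mitl_somewhere \<alpha>)"
| "child_pos_mitl (TX \<theta> \<eta>) \<alpha> V =
     (let \<psi> = MAnd (gevent_mitl V \<theta>) (mitl_past \<alpha>) in MAnd \<psi> (MNot (mitl_past \<psi>)))"
| "child_pos_mitl (TY \<theta> \<eta>) \<alpha> V =
     (let \<psi> = MAnd (gevent_mitl V \<theta>) (mitl_future \<alpha>) in MAnd \<psi> (MNot (mitl_future \<psi>)))"
| "child_pos_mitl (TFreeze x \<eta>) \<alpha> V = \<alpha>"
| "child_pos_mitl (TOr \<eta> \<zeta>) \<alpha> V = \<alpha>"
| "child_pos_mitl (TNot \<eta>) \<alpha> V = \<alpha>"

text \<open>At a freeze node \<open>\<alpha>\<close> marks the very position whose time stamp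
  \<open>x\<close> receives.\<close>

fun child_val_mitl :: "('a, 'x) ttl \<Rightarrow> 'a mitl \<Rightarrow> ('x \<Rightarrow> 'a mitl) \<Rightarrow> 'x \<Rightarrow> 'a mitl" where
  "child_val_mitl (TFreeze x \<eta>) \<alpha> V = V(x := \<alpha>)"
| "child_val_mitl _ \<alpha> V = V"

text \<open>Each clause is false outright or implies that \<open>\<alpha>\<close> holds
  somewhere.\<close>

lemma encodes_child_None:
  assumes "timed_word \<rho>" "encodes \<alpha> V \<rho> None"
  shows "encodes (child_pos_mitl \<eta> \<alpha> V) W \<rho> None"
  using assms
  by (cases \<eta>) (auto simp: encodes_def mitl_sat_somewhere mitl_sat_past mitl_sat_future Let_def)

text \<open>Since \<open>\<alpha>\<close> holds only at \<open>i\<close>,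
  \<open>mitl_past \<alpha>\<close> holds at \<open>k\<close> exactly if \<open>i < k\<close>, which
  turns the formula for \<open>TX\<close> into the characterisation of \<open>next_pos\<close>;
  \<open>TY\<close> is symmetric. For \<open>TSP\<close> and \<open>TEP\<close> the search for
  \<open>\<alpha>\<close> succeeds, leaving the test for an end of the word.\<close>

lemma encodes_child_Some:
  assumes \<rho>: "timed_word \<rho>" and enc: "encodes \<alpha> V \<rho> (Some (i, \<nu>))"
  shows "encodes (child_pos_mitl \<eta> \<alpha> V) (child_val_mitl \<eta> \<alpha> V) \<rho> (child_config \<rho> \<eta> i \<nu>)"
proof -
  have V: "represents \<rho> V \<nu>"
    using enc by (simp add: encodes_def)
  show ?thesis
  proof (cases \<eta>)
    case (TX \<theta> \<zeta>)
    let ?\<alpha> = "child_pos_mitl \<eta> \<alpha> V"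
    \<comment> \<open>This pointwise equivalence settles both cases below: no \<open>k\<close> is
      marked if \<open>next_pos\<close> is \<open>None\<close>, and only \<open>j\<close> if it is
      \<open>Some j\<close>.\<close>
    have sat: "mitl_sat \<rho> k ?\<alpha> \<longleftrightarrow> next_pos \<rho> i \<nu> \<theta> = Some k" if "k \<in> tw_dom \<rho>" for k
      using that enc
      by (auto simp: TX Let_def mitl_sat_gevent[OF \<rho> _ V] mitl_sat_past[OF \<rho>]
          next_pos_eq_Some_iff encodes_def holds_only_at_def)
    show ?thesis
    proof (cases "next_pos \<rho> i \<nu> \<theta>")
      case None
      then show ?thesis
        using sat by (simp add: TX encodes_def)
    next
      case (Some j)
      then have "j \<in> tw_dom \<rho>"
        by (simp add: next_pos_eq_Some_iff)
      then have "holds_only_at \<rho> ?\<alpha> j"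
        using sat Some by (auto simp: holds_only_at_def)
      then show ?thesis
        using V Some by (simp add: TX encodes_def)
    qed
  next
    case (TY \<theta> \<zeta>)
    let ?\<alpha> = "child_pos_mitl \<eta> \<alpha> V"
    have sat: "mitl_sat \<rho> k ?\<alpha> \<longleftrightarrow> prev_pos \<rho> i \<nu> \<theta> = Some k" if "k \<in> tw_dom \<rho>" for k
      using that enc
      by (auto simp: TY Let_def mitl_sat_gevent[OF \<rho> _ V] mitl_sat_future[OF \<rho>]
          prev_pos_eq_Some_iff encodes_def holds_only_at_def)
    show ?thesis
    proof (cases "prev_pos \<rho> i \<nu> \<theta>")
      case None
      then show ?thesis
        using sat by (simp add: TY encodes_def)
    next
      case (Some j)
      then have "j \<in> tw_dom \<rho>"
        by (simp add: prev_pos_eq_Some_iff)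
      then have "holds_only_at \<rho> ?\<alpha> j"
        using sat Some by (auto simp: holds_only_at_def)
      then show ?thesis
        using V Some by (simp add: TY encodes_def)
    qed
  next
    case (TFreeze x \<zeta>)
    then show ?thesis
      using enc by (auto simp: encodes_def represents_def)
  qed (use enc \<rho> in \<open>auto simp: encodes_def holds_only_at_def mitl_sat_somewhere mitl_sat_first
      mitl_sat_last first_in_tw_dom[simplified] last_in_tw_dom\<close>)
qed

lemma encodes_child:
  assumes "timed_word \<rho>" "encodes \<alpha> V \<rho> c"
  shows "encodes (child_pos_mitl \<eta> \<alpha> V) (child_val_mitl \<eta> \<alpha> V) \<rho>
    (Option.bind c (\<lambda>(i, \<nu>). child_config \<rho> \<eta> i \<nu>))"
  using assms encodes_child_None encodes_child_Some by (cases c) auto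

text \<open>The time stamp of position 1 is 0, so \<open>mitl_first\<close> marks the initial
  position and also represents the initial value of every variable.\<close>

lemma encodes_root:
  assumes "timed_word \<rho>"
  shows "encodes mitl_first (\<lambda>_. mitl_first) \<rho> (Some (1, \<nu>\<^sub>0))"
  using assms first_in_tw_dom[OF assms]
  by (auto simp: encodes_def represents_def holds_only_at_def val_zero_def mitl_sat_first
      timed_word_def intro!: exI[of _ 1])

section \<open>Configurations along a path of the parse tree\<close>

fun node_pos_mitl :: "('a, 'x) ttl \<Rightarrow> 'a mitl \<Rightarrow> ('x \<Rightarrow> 'a mitl) \<Rightarrow> nat list \<Rightarrow> 'a mitl" where
  "node_pos_mitl \<eta> \<alpha> V [] = \<alpha>"
| "node_pos_mitl \<eta> \<alpha> V (k # p) =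
     node_pos_mitl (ttl_children \<eta> ! k) (child_pos_mitl \<eta> \<alpha> V) (child_val_mitl \<eta> \<alpha> V) p"

fun node_val_mitl ::
  "('a, 'x) ttl \<Rightarrow> 'a mitl \<Rightarrow> ('x \<Rightarrow> 'a mitl) \<Rightarrow> nat list \<Rightarrow> 'x \<Rightarrow> 'a mitl" where
  "node_val_mitl \<eta> \<alpha> V [] = V"
| "node_val_mitl \<eta> \<alpha> V (k # p) =
     node_val_mitl (ttl_children \<eta> ! k) (child_pos_mitl \<eta> \<alpha> V) (child_val_mitl \<eta> \<alpha> V) p"

lemma config_from_None [simp]: "config_from \<rho> \<eta> None p = None"
  by (cases p) auto

text \<open>The bind treats reached and unreached nodes alike, so the induction along a path has a
  single kind of step.\<close>

lemma config_from_Cons: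
  "config_from \<rho> \<eta> c (k # p) =
     config_from \<rho> (ttl_children \<eta> ! k) (Option.bind c (\<lambda>(i, \<nu>). child_config \<rho> \<eta> i \<nu>)) p"
  by (cases c) auto

lemma encodes_node:
  assumes "timed_word \<rho>" "encodes \<alpha> V \<rho> c"
  shows "encodes (node_pos_mitl \<eta> \<alpha> V p) (node_val_mitl \<eta> \<alpha> V p) \<rho> (config_from \<rho> \<eta> c p)"
  using assms(2)
proof (induction p arbitrary: \<eta> \<alpha> V c)
  case (Cons k p)
  show ?case
    unfolding config_from_Cons node_pos_mitl.simps node_val_mitl.simps
    by (rule Cons.IH) (rule encodes_child[OF assms(1) Cons.prems])
qed simp

section \<open>Truth values from the leaves upwards\<close>

definition visit_mitl ::
  "('a, 'x) ttl \<Rightarrow> 'a mitl \<Rightarrow> ('x \<Rightarrow> 'a mitl) \<Rightarrow> 'a mitl \<Rightarrow> 'a mitl" where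
  "visit_mitl \<eta> \<alpha> V \<chi> = mitl_somewhere (MAnd (child_pos_mitl \<eta> \<alpha> V) \<chi>)"

text \<open>Disjunction, negation and freezing keep the position, so the formulas of the children
  are used in place; the other four modalities may move and have to look for the child.\<close>

fun eval_mitl :: "('a, 'x) ttl \<Rightarrow> 'a mitl \<Rightarrow> ('x \<Rightarrow> 'a mitl) \<Rightarrow> 'a mitl" where
  "eval_mitl TTop \<alpha> V = mitl_top"
| "eval_mitl (TEvent \<theta>) \<alpha> V = gevent_mitl V \<theta>"
| "eval_mitl (TOr \<eta> \<zeta>) \<alpha> V = mitl_or (eval_mitl \<eta> \<alpha> V) (eval_mitl \<zeta> \<alpha> V)"
| "eval_mitl (TNot \<eta>) \<alpha> V = MNot (eval_mitl \<eta> \<alpha> V)"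
| "eval_mitl (TFreeze x \<eta>) \<alpha> V = eval_mitl \<eta> \<alpha> (V(x := \<alpha>))"
| "eval_mitl (TSP \<eta>) \<alpha> V =
     visit_mitl (TSP \<eta>) \<alpha> V (eval_mitl \<eta> (child_pos_mitl (TSP \<eta>) \<alpha> V) V)"
| "eval_mitl (TEP \<eta>) \<alpha> V =
     visit_mitl (TEP \<eta>) \<alpha> V (eval_mitl \<eta> (child_pos_mitl (TEP \<eta>) \<alpha> V) V)"
| "eval_mitl (TX \<theta> \<eta>) \<alpha> V =
     visit_mitl (TX \<theta> \<eta>) \<alpha> V (eval_mitl \<eta> (child_pos_mitl (TX \<theta> \<eta>) \<alpha> V) V)"
| "eval_mitl (TY \<theta> \<eta>) \<alpha> V =
     visit_mitl (TY \<theta> \<eta>) \<alpha> V (eval_mitl \<eta> (child_pos_mitl (TY \<theta> \<eta>) \<alpha> V) V)"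

text \<open>The child's formula marks one position or none, so the existential search either tests
  \<open>\<chi>\<close> exactly there or fails.\<close>

lemma mitl_sat_visit:
  assumes "timed_word \<rho>" "encodes \<alpha> V \<rho> (Some (i, \<nu>))"
  shows "mitl_sat \<rho> i (visit_mitl \<eta> \<alpha> V \<chi>) \<longleftrightarrow>
    (\<exists>j \<mu>. child_config \<rho> \<eta> i \<nu> = Some (j, \<mu>) \<and> mitl_sat \<rho> j \<chi>)"
proof -
  have "i \<in> tw_dom \<rho>"
    using assms(2) by (simp add: encodes_def holds_only_at_def)
  with encodes_child_Some[OF assms, of \<eta>] show ?thesis
    unfolding visit_mitl_def mitl_sat_somewhere[OF assms(1) \<open>i \<in> tw_dom \<rho>\<close>]
    by (cases "child_config \<rho> \<eta> i \<nu>") (auto simp: encodes_def holds_only_at_def)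
qed

lemma ttl_sat_TX_next_pos:
  assumes "i \<in> tw_dom \<rho>"
  shows "ttl_sat \<rho> i \<nu> (TX \<theta> \<eta>) \<longleftrightarrow>
    (\<exists>j. next_pos \<rho> i \<nu> \<theta> = Some j \<and> ttl_sat \<rho> j \<nu> \<eta>)"
proof -
  \<comment> \<open>The semantics lets \<open>k\<close> range over all naturals,
    \<open>next_pos\<close> only over the domain; strictly between \<open>i\<close> and
    \<open>j\<close> the two ranges agree.\<close>
  have "k \<in> tw_dom \<rho>" if "i < k" "k < j" "j \<in> tw_dom \<rho>" for j k
    using that by (auto simp: tw_dom_def)
  then show ?thesis
    by (auto simp: next_pos_eq_Some_iff)
qed

lemma ttl_sat_TY_prev_pos:
  assumes "i \<in> tw_dom \<rho>"
  shows "ttl_sat \<rho> i \<nu> (TY \<theta> \<eta>) \<longleftrightarrow>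
    (\<exists>j. prev_pos \<rho> i \<nu> \<theta> = Some j \<and> ttl_sat \<rho> j \<nu> \<eta>)"
proof -
  \<comment> \<open>Here the upper bound on \<open>k\<close> comes from \<open>i\<close> being a
    position of the word.\<close>
  have "k \<in> tw_dom \<rho>" if "j < k" "k < i" "j \<in> tw_dom \<rho>" for j k
    using that assms by (auto simp: tw_dom_def)
  then show ?thesis
    by (auto simp: prev_pos_eq_Some_iff)
qed

text \<open>The equivalence is claimed only at the marked position of a reached node, so negation
  does no harm. If \<open>TX\<close> or \<open>TY\<close> finds no event, both sides are false and
  the child is never consulted; otherwise the induction hypothesis applies to the child's own
  encoding.\<close>

lemma mitl_sat_eval:
  assumes \<rho>: "timed_word \<rho>" and "encodes \<alpha> V \<rho> (Some (i, \<nu>))"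
  shows "mitl_sat \<rho> i (eval_mitl \<eta> \<alpha> V) \<longleftrightarrow> ttl_sat \<rho> i \<nu> \<eta>"
  using assms(2)
proof (induction \<eta> arbitrary: \<alpha> V i \<nu>)
  case (TEvent \<theta>)
  then show ?case
    by (simp add: encodes_def holds_only_at_def mitl_sat_gevent[OF \<rho>])
next
  case (TSP \<eta>)
  then show ?case
    using encodes_child_Some[OF \<rho> TSP.prems, of "TSP \<eta>"]
    by (simp add: mitl_sat_visit[OF \<rho>] del: child_pos_mitl.simps)
next
  case (TEP \<eta>)
  then show ?case
    using encodes_child_Some[OF \<rho> TEP.prems, of "TEP \<eta>"]
    by (simp add: mitl_sat_visit[OF \<rho>] del: child_pos_mitl.simps)
next
  case (TX \<theta> \<eta>)
  have "i \<in> tw_dom \<rho>"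
    using TX.prems by (simp add: encodes_def holds_only_at_def)
  then show ?case
    using encodes_child_Some[OF \<rho> TX.prems, of "TX \<theta> \<eta>"] TX
    unfolding ttl_sat_TX_next_pos[OF \<open>i \<in> tw_dom \<rho>\<close>]
    by (cases "next_pos \<rho> i \<nu> \<theta>") (auto simp: mitl_sat_visit[OF \<rho>] simp del: child_pos_mitl.simps)
next
  case (TY \<theta> \<eta>)
  have "i \<in> tw_dom \<rho>"
    using TY.prems by (simp add: encodes_def holds_only_at_def)
  then show ?case
    using encodes_child_Some[OF \<rho> TY.prems, of "TY \<theta> \<eta>"] TY
    unfolding ttl_sat_TY_prev_pos[OF \<open>i \<in> tw_dom \<rho>\<close>]
    by (cases "prev_pos \<rho> i \<nu> \<theta>") (auto simp: mitl_sat_visit[OF \<rho>] simp del: child_pos_mitl.simps)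
next
  case (TFreeze x \<eta>)
  then show ?case
    using encodes_child_Some[OF \<rho> TFreeze.prems, of "TFreeze x \<eta>"] by simp
qed auto

theorem theorem6:
  fixes \<phi> :: "('a::finite, 'x::finite) ttl"
  shows "\<exists>\<beta> :: nat list \<Rightarrow> 'a mitl.
    (\<forall>p. is_node \<phi> p \<longrightarrow>
       (\<forall>\<rho>. timed_word \<rho> \<longrightarrow>
          (ttl_eval \<rho> \<phi> p \<longleftrightarrow>
             ttl_pos \<rho> \<phi> p \<noteq> None \<and> mitl_sat \<rho> (the (ttl_pos \<rho> \<phi> p)) (\<beta> p)))) \<and>
    (\<forall>\<rho>. timed_word \<rho> \<longrightarrow> (ttl_sat \<rho> 1 \<nu>\<^sub>0 \<phi> \<longleftrightarrow> mitl_sat \<rho> 1 (\<beta> [])))"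
proof -
  define \<alpha> where "\<alpha> = node_pos_mitl \<phi> mitl_first (\<lambda>_. mitl_first)"
  define V where "V = node_val_mitl \<phi> mitl_first (\<lambda>_. mitl_first)"
  \<comment> \<open>Only \<open>\<phi>\<close> and the path enter here, so one formula serves every
    timed word.\<close>
  define \<beta> where "\<beta> p = eval_mitl (subformula_at \<phi> p) (\<alpha> p) (V p)" for p
  have \<beta>: "mitl_sat \<rho> i (\<beta> p) \<longleftrightarrow> ttl_sat \<rho> i \<nu> (subformula_at \<phi> p)"
    if "timed_word \<rho>" "config_from \<rho> \<phi> (Some (1, \<nu>\<^sub>0)) p = Some (i, \<nu>)" for \<rho> p i \<nu>
    using encodes_node[OF that(1) encodes_root[OF that(1)], of \<phi> p] mitl_sat_eval[OF that(1)] that(2)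
    by (simp add: \<beta>_def \<alpha>_def V_def)
  have "ttl_eval \<rho> \<phi> p \<longleftrightarrow>
      ttl_pos \<rho> \<phi> p \<noteq> None \<and> mitl_sat \<rho> (the (ttl_pos \<rho> \<phi> p)) (\<beta> p)" if "timed_word \<rho>" for \<rho> p
    using \<beta>[OF that, of p] by (auto simp: ttl_eval_def ttl_pos_def ttl_val_def)
  moreover have "ttl_sat \<rho> 1 \<nu>\<^sub>0 \<phi> \<longleftrightarrow> mitl_sat \<rho> 1 (\<beta> [])" if "timed_word \<rho>" for \<rho>
    using \<beta>[OF that, of "[]"] by simp
  ultimately show ?thesis
    by blast
qed

end
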